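(* Let $\bar t=\inf\{t>0\mid B'_t=M\}$, where $B'_t=\{q\in M\mid d'(q_0,q)\le t\}$ and $q_0=\pi(\mathrm{Id})$. Let $\bar g=\left(\frac12,\frac12,\frac12\right)\in G$ and $\tilde g=(1,0,0)\in G$ in the coordinates $(a,b,c)$. Then $$\bar t\ge d(\tilde g,\bar g).$$
   Context: $G$ is the 3D Heisenberg group of real unipotent upper triangular matrices $\begin{pmatrix}1&a&c\\0&1&b\\0&0&1\end{pmatrix}$, with coordinates $(a,b,c)$ and product $(a,b,c)\cdot(\bar a,\bar b,\bar c)=(a+\bar a,\,b+\bar b,\,c+\bar c+a\bar b)$. $H\subset G$ is the discrete subgroup of elements with $a,b,c\in\mathbb Z$, $M=H\backslash G=\{Hg\mid g\in G\}$ is the compact Heisenberg nil-manifold, and $\pi:G\to M$, $g\mapsto Hg$. The left-invariant fields $X_1=\partial_a$, $X_2=\partial_b+a\,\partial_c$ on $G$ (equivalently $X_1=\partial_x-\frac y2\partial_z$, $X_2=\partial_y+\frac x2\partial_z$ in coordinates $x=a$, $y=b$, $z=c-\frac{ab}2$) project to fields $X_1',X_2'$ on $M$. $d$ (resp. $d'$) is the sub-Riemannian distance on $G$ (resp. $M$) with orthonormal frame $X_1,X_2$ (resp. $X_1',X_2'$): the infimum of $\int_0^{t_1}(u_1^2+u_2^2)^{1/2}dt$ over Lipschitz curves joining the two points and tangent a.e. to $u_1X_1+u_2X_2$ (resp. $u_1X_1'+u_2X_2'$). *)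

theory Defs
  imports "HOL-Analysis.Analysis" "HOL-Algebra.Coset"
begin

type_synonym point = "real \<times> real \<times> real"

text \<open>The triple \<open>(a, b, c)\<close> stands for the unipotent matrix with \<open>a\<close>, \<open>b\<close> on the superdiagonal
  and \<open>c\<close> in the corner; see \<open>heis_matrix_mult\<close> below.\<close>

definition heis :: "point monoid" where
  "heis = \<lparr>carrier = UNIV,
           mult = (\<lambda>(a, b, c) (a', b', c'). (a + a', b + b', c + c' + a * b')),
           one = (0, 0, 0)\<rparr>"

definition heis_matrix :: "point \<Rightarrow> real^3^3" where
  "heis_matrix = (\<lambda>(a, b, c). vector [vector [1, a, c], vector [0, 1, b], vector [0, 0, 1]])"

lemma heis_matrix_mult:
  "heis_matrix (g \<otimes>\<^bsub>heis\<^esub> h) = heis_matrix g ** heis_matrix h"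
  by (cases g; cases h)
     (simp add: heis_def heis_matrix_def vec_eq_iff forall_3 matrix_matrix_mult_def sum_3)

lemma group_heis: "group heis"
proof (rule groupI)
  fix x assume "x \<in> carrier heis"
  obtain a b c where "x = (a, b, c)" by (cases x)
  then have "(- a, - b, a * b - c) \<otimes>\<^bsub>heis\<^esub> x = \<one>\<^bsub>heis\<^esub>"
    by (simp add: heis_def)
  moreover have "(- a, - b, a * b - c) \<in> carrier heis"
    by (simp add: heis_def)
  ultimately show "\<exists>y\<in>carrier heis. y \<otimes>\<^bsub>heis\<^esub> x = \<one>\<^bsub>heis\<^esub>"
    by blast
qed (auto simp: heis_def algebra_simps)

definition heis_int :: "point set" where
  "heis_int = \<int> \<times> \<int> \<times> \<int>"

lemma subgroup_heis_int: "subgroup heis_int heis"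
proof -
  interpret group heis by (rule group_heis)
  show ?thesis
  proof (rule subgroupI)
    fix x assume x: "x \<in> heis_int"
    obtain a b c where abc: "x = (a, b, c)" by (cases x)
    then have "inv\<^bsub>heis\<^esub> x = (- a, - b, a * b - c)"
      by (intro inv_equality) (simp_all add: heis_def)
    then show "inv\<^bsub>heis\<^esub> x \<in> heis_int"
      using x abc by (simp add: heis_int_def)
  qed (auto simp: heis_def heis_int_def)
qed

definition nil_proj :: "point \<Rightarrow> point set" where
  "nil_proj g = heis_int #>\<^bsub>heis\<^esub> g"

definition nil_manifold :: "point set set" where
  "nil_manifold = rcosets\<^bsub>heis\<^esub> heis_int"

lemma nil_manifold_eq: "nil_manifold = range nil_proj"
  by (auto simp: nil_manifold_def RCOSETS_def nil_proj_def heis_def)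

definition X1 :: "point \<Rightarrow> point" where
  "X1 = (\<lambda>(a, b, c). (1, 0, 0))"

definition X2 :: "point \<Rightarrow> point" where
  "X2 = (\<lambda>(a, b, c). (0, 1, a))"

text \<open>Lengths and distances take values in the extended nonnegative reals, so that the infimum
  over an empty family of curves is \<open>\<infinity>\<close>.  The speed of a Lipschitz horizontal curve is
  automatically bounded and Lebesgue measurable, since \<open>u1\<close>, \<open>u2\<close> are a.e. determined by the
  derivative of the curve.\<close>

definition control_length :: "real \<Rightarrow> (real \<Rightarrow> real) \<Rightarrow> (real \<Rightarrow> real) \<Rightarrow> ennreal" where
  "control_length T u1 u2 =
     (\<integral>\<^sup>+ t\<in>{0..T}. ennreal (sqrt ((u1 t)\<^sup>2 + (u2 t)\<^sup>2)) \<partial>lebesgue)"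

definition heis_horizontal ::
    "real \<Rightarrow> (real \<Rightarrow> point) \<Rightarrow> (real \<Rightarrow> real) \<Rightarrow> (real \<Rightarrow> real) \<Rightarrow> bool" where
  "heis_horizontal T \<gamma> u1 u2 \<longleftrightarrow>
     (\<exists>L. L-lipschitz_on {0..T} \<gamma>) \<and>
     (AE t in lebesgue. t \<in> {0..T} \<longrightarrow>
        (\<gamma> has_vector_derivative u1 t *\<^sub>R X1 (\<gamma> t) + u2 t *\<^sub>R X2 (\<gamma> t)) (at t within {0..T}))"

definition heis_dist :: "point \<Rightarrow> point \<Rightarrow> ennreal" where
  "heis_dist p q =
     Inf {control_length T u1 u2 | T u1 u2 \<gamma>.
            0 < T \<and> heis_horizontal T \<gamma> u1 u2 \<and> \<gamma> 0 = p \<and> \<gamma> T = q}"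

text \<open>The smooth structure of \<open>nil_manifold\<close> is the one making the projection a local diffeomorphism: its
  charts are the inverses of the projection restricted to open sets on which it is injective.\<close>

definition chart_domain :: "point set \<Rightarrow> bool" where
  "chart_domain U \<longleftrightarrow> open U \<and> inj_on nil_proj U"

definition nil_chart :: "point set \<Rightarrow> point set \<Rightarrow> point" where
  "nil_chart U = inv_into U nil_proj"

lemma chart_domain_ball: "chart_domain (ball g (1/2))"
proof -
  have "p = q" if p: "p \<in> ball g (1/2)" and q: "q \<in> ball g (1/2)"
    and eq: "nil_proj p = nil_proj q" for p q
  proof -
    have less: "dist p q < 1"
      using p q dist_triangle_half_r[of g p 1 q] by simp
    have "p \<in> nil_proj p"
      by (cases p) (force simp: nil_proj_def r_coset_def heis_int_def heis_def)
    then have "p \<in> nil_proj q" using eq by simp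
    then obtain k l m where klm: "(k, l, m) \<in> heis_int" and pq: "p = (k, l, m) \<otimes>\<^bsub>heis\<^esub> q"
      by (auto simp: nil_proj_def r_coset_def)
    obtain a b c where abc: "q = (a, b, c)" by (cases q)
    have p': "p = (k + a, l + b, m + c + k * b)"
      using pq abc by (simp add: heis_def)
    have "\<bar>k\<bar> < 1"
      using less dist_fst_le[of p q] by (simp add: p' abc dist_real_def)
    then have k: "k = 0" using klm Ints_nonzero_abs_less1 by (auto simp: heis_int_def)
    have s: "dist (l + b, m + c) (b, c) < 1"
      using less dist_snd_le[of p q] by (simp add: p' abc k)
    have "\<bar>l\<bar> < 1" "\<bar>m\<bar> < 1"
      using s dist_fst_le[of "(l + b, m + c)" "(b, c)"] dist_snd_le[of "(l + b, m + c)" "(b, c)"]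
      by (simp_all add: dist_real_def)
    then have "l = 0" "m = 0"
      using klm Ints_nonzero_abs_less1 by (auto simp: heis_int_def)
    then show ?thesis using p' abc k by simp
  qed
  then show ?thesis by (auto simp: chart_domain_def inj_on_def)
qed

definition nil_lipschitz :: "real \<Rightarrow> (real \<Rightarrow> point set) \<Rightarrow> bool" where
  "nil_lipschitz T \<gamma> \<longleftrightarrow>
     (\<forall>s\<in>{0..T}. \<exists>U \<epsilon> L. chart_domain U \<and> 0 < \<epsilon> \<and>
        \<gamma> ` ({0..T} \<inter> ball s \<epsilon>) \<subseteq> nil_proj ` U \<and>
        L-lipschitz_on ({0..T} \<inter> ball s \<epsilon>) (nil_chart U \<circ> \<gamma>))"

text \<open>Since a chart is a local inverse of the projection, the projected fields are represented in
  it by \<open>X1\<close> and \<open>X2\<close>.  As usual, tangency does not depend on the chart around \<open>\<gamma> t\<close>, as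
  transition maps are locally left translations by elements of \<open>heis_int\<close>.\<close>

definition nil_horizontal ::
    "real \<Rightarrow> (real \<Rightarrow> point set) \<Rightarrow> (real \<Rightarrow> real) \<Rightarrow> (real \<Rightarrow> real) \<Rightarrow> bool" where
  "nil_horizontal T \<gamma> u1 u2 \<longleftrightarrow>
     nil_lipschitz T \<gamma> \<and>
     (AE t in lebesgue. t \<in> {0..T} \<longrightarrow>
        (\<exists>U. chart_domain U \<and> \<gamma> t \<in> nil_proj ` U \<and>
           ((nil_chart U \<circ> \<gamma>) has_vector_derivative
              u1 t *\<^sub>R X1 (nil_chart U (\<gamma> t)) + u2 t *\<^sub>R X2 (nil_chart U (\<gamma> t)))
             (at t within {0..T})))"

definition nil_dist :: "point set \<Rightarrow> point set \<Rightarrow> ennreal" where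
  "nil_dist p q =
     Inf {control_length T u1 u2 | T u1 u2 \<gamma>.
            0 < T \<and> nil_horizontal T \<gamma> u1 u2 \<and> \<gamma> 0 = p \<and> \<gamma> T = q}"

definition nil_ball :: "real \<Rightarrow> point set set" where
  "nil_ball t = {q \<in> nil_manifold. nil_dist (nil_proj \<one>\<^bsub>heis\<^esub>) q \<le> ennreal t}"

definition t_bar :: ennreal where
  "t_bar = Inf {ennreal t | t. 0 < t \<and> nil_ball t = nil_manifold}"

end

theory Submission
  imports Defs
begin

text \<open>The covering time is at least the distance from the base point to any point of the
  nilmanifold, and the point to look at is the class of the centre \<open>(1/2, 1/2, 1/2)\<close> of the
  fundamental cube. A horizontal curve in the nilmanifold from the class of the identity to this
  class lifts, with the same controls, to a horizontal curve in the group from \<open>(0, 0, 0)\<close> to some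
  point \<open>g\<close> of the coset (\<open>nil_horizontal_lift\<close>). So it is enough to show that \<open>(1, 0, 0)\<close> and
  \<open>(1/2, 1/2, 1/2)\<close>, or after a left translation \<open>(0, 0, 0)\<close> and \<open>(- 1/2, 1/2, 0)\<close>, are no farther
  apart than \<open>(0, 0, 0)\<close> and \<open>g\<close>, for every \<open>g\<close> in the coset (\<open>heis_dist_le_of_centre_coset\<close>).

  No geodesic is computed. A smooth map whose derivative sends horizontal vectors to horizontal
  vectors that are no longer decreases the distance (\<open>heis_dist_horizontal_contraction\<close>), and for
  each \<open>g\<close> there is such a map that fixes \<open>(0, 0, 0)\<close> and sends \<open>g\<close> to \<open>(- 1/2, 1/2, 0)\<close>.
  In the symmetric coordinate \<open>z = c - a * b / 2\<close>, which along a horizontal curve from the identity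
  is the signed area between the planar projection of the curve and its chord, the target has
  chord \<open>(- 1/2, 1/2)\<close> and \<open>z = 1/8\<close>, whereas \<open>g\<close> has a chord \<open>(A, B)\<close> with half-odd entries and
  a \<open>z\<close> such that \<open>8 * z\<close> is an odd integer, so that \<open>\<bar>z\<bar> \<ge> 1/8\<close>. There are two cases.

  If the chord of \<open>g\<close> is as short as the one of the target, then the plane is rotated to align the
  chords and compressed, possibly with a reflection, by the factor \<open>1 / (8 * z)\<close> in the direction
  orthogonal to the chord. This linear contraction multiplies areas by \<open>1 / (8 * z)\<close>, and it lifts
  to an automorphism of the group.

  Otherwise the chord has length at least \<open>sqrt (5/2)\<close>. An explicit curve from \<open>(0, 0, 0)\<close> to
  \<open>(- 1/2, 1/2, 0)\<close>, one half-wave of a sine over the chord, has speed at most \<open>sqrt (5/2)\<close> on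
  \<open>[0, 1]\<close> and, being continued as a sine, everywhere else. Composing it with the orthogonal
  projection to the chord of \<open>g\<close>, normalised to run from \<open>0\<close> to \<open>1\<close>, gives the map needed.\<close>

section \<open>Maps that do not increase length\<close>

lemma heis_mult: "(a, b, c) \<otimes>\<^bsub>heis\<^esub> (a', b', c') = (a + a', b + b', c + c' + a * b')"
  by (simp add: heis_def)

text \<open>The derivatives are required to depend continuously on the point because a horizontal curve is
  Lipschitz: its image under the map is Lipschitz again as soon as the map is Lipschitz on
  bounded sets.\<close>

definition horizontal_contraction :: "(point \<Rightarrow> point) \<Rightarrow> bool" where
  "horizontal_contraction \<Phi> \<longleftrightarrow>
     (\<exists>D. (\<forall>p. (\<Phi> has_derivative D p) (at p)) \<and> (\<forall>v. continuous_on UNIV (\<lambda>p. D p v)) \<and>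
        (\<forall>p u1 u2. \<exists>v1 v2. D p (u1 *\<^sub>R X1 p + u2 *\<^sub>R X2 p) = v1 *\<^sub>R X1 (\<Phi> p) + v2 *\<^sub>R X2 (\<Phi> p) \<and>
           v1\<^sup>2 + v2\<^sup>2 \<le> u1\<^sup>2 + u2\<^sup>2))"

lemma continuously_differentiable_lipschitz_on_cball:
  fixes \<Phi> :: "'a::euclidean_space \<Rightarrow> 'b::real_normed_vector"
  assumes D: "\<And>p. (\<Phi> has_derivative D p) (at p)"
    and cont: "\<And>v. continuous_on UNIV (\<lambda>p. D p v)"
  shows "\<exists>L. L-lipschitz_on (cball 0 r) \<Phi>"
proof -
  have app: "blinfun_apply (Blinfun (D p)) = D p" for p
    using D has_derivative_bounded_linear bounded_linear_Blinfun_apply by blast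
  have "continuous_on (cball 0 r) (\<lambda>p. norm (Blinfun (D p)))"
    by (intro continuous_on_norm continuous_on_blinfun_componentwise)
       (simp add: app continuous_on_subset[OF cont])
  then have "bounded ((\<lambda>p. norm (Blinfun (D p))) ` cball 0 r)"
    by (intro compact_imp_bounded compact_continuous_image) auto
  then obtain C where "\<forall>x \<in> (\<lambda>p. norm (Blinfun (D p))) ` cball 0 r. norm x \<le> C"
    unfolding bounded_iff by blast
  then have C: "norm (Blinfun (D p)) \<le> C" if "p \<in> cball 0 r" for p
    using that by simp
  have "(max C 0)-lipschitz_on (cball 0 r) \<Phi>"
  proof (rule bounded_derivative_imp_lipschitz)
    fix p :: 'a assume "p \<in> cball 0 r"
    then show "onorm (D p) \<le> max C 0"
      using C[of p] by (simp add: norm_blinfun.rep_eq app)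
  qed (auto intro: has_derivative_at_withinI D)
  then show ?thesis by blast
qed

lemma lipschitz_on_interval_compose:
  fixes \<gamma> :: "real \<Rightarrow> 'a::euclidean_space" and \<Phi> :: "'a \<Rightarrow> 'b::real_normed_vector"
  assumes "\<And>p. (\<Phi> has_derivative D p) (at p)" "\<And>v. continuous_on UNIV (\<lambda>p. D p v)"
    and \<gamma>: "L-lipschitz_on {s..t} \<gamma>"
  shows "\<exists>L. L-lipschitz_on {s..t} (\<lambda>\<tau>. \<Phi> (\<gamma> \<tau>))"
proof -
  have "bounded (\<gamma> ` {s..t})"
    using \<gamma> by (intro compact_imp_bounded compact_continuous_image lipschitz_on_continuous_on) auto
  then obtain r where r: "\<gamma> ` {s..t} \<subseteq> cball 0 r"
    unfolding bounded_iff by fastforce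
  obtain M where "M-lipschitz_on (cball 0 r) \<Phi>"
    using continuously_differentiable_lipschitz_on_cball assms by blast
  then show ?thesis
    using lipschitz_on_compose2[OF \<gamma>] lipschitz_on_subset[OF _ r] by blast
qed

text \<open>The image of an admissible curve is admissible and pointwise no faster, so the inequality of
  lengths is monotonicity of the integral. Since the map also carries the end points along, the
  curve never has to be recovered from its derivative.\<close>

proposition heis_dist_horizontal_contraction:
  assumes "horizontal_contraction \<Phi>"
  shows "heis_dist (\<Phi> p) (\<Phi> q) \<le> heis_dist p q"
proof -
  obtain D where D: "\<And>p. (\<Phi> has_derivative D p) (at p)" and cont: "\<And>v. continuous_on UNIV (\<lambda>p. D p v)"
    and contr: "\<And>p u1 u2. \<exists>v1 v2. D p (u1 *\<^sub>R X1 p + u2 *\<^sub>R X2 p)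
                  = v1 *\<^sub>R X1 (\<Phi> p) + v2 *\<^sub>R X2 (\<Phi> p) \<and> v1\<^sup>2 + v2\<^sup>2 \<le> u1\<^sup>2 + u2\<^sup>2"
    using assms unfolding horizontal_contraction_def by blast
  have "heis_dist (\<Phi> p) (\<Phi> q) \<le> control_length T u1 u2"
    if T: "0 < T" and hor: "heis_horizontal T \<gamma> u1 u2" and ends: "\<gamma> 0 = p" "\<gamma> T = q" for T u1 u2 \<gamma>
  proof -
    have "\<exists>v1 v2. D (\<gamma> t) (u1 t *\<^sub>R X1 (\<gamma> t) + u2 t *\<^sub>R X2 (\<gamma> t))
          = v1 *\<^sub>R X1 (\<Phi> (\<gamma> t)) + v2 *\<^sub>R X2 (\<Phi> (\<gamma> t)) \<and> v1\<^sup>2 + v2\<^sup>2 \<le> (u1 t)\<^sup>2 + (u2 t)\<^sup>2" for t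
      by (rule contr)
    then obtain v1 v2 where v: "\<And>t. D (\<gamma> t) (u1 t *\<^sub>R X1 (\<gamma> t) + u2 t *\<^sub>R X2 (\<gamma> t))
          = v1 t *\<^sub>R X1 (\<Phi> (\<gamma> t)) + v2 t *\<^sub>R X2 (\<Phi> (\<gamma> t))"
        and le: "\<And>t. (v1 t)\<^sup>2 + (v2 t)\<^sup>2 \<le> (u1 t)\<^sup>2 + (u2 t)\<^sup>2"
      by metis
    obtain L where "L-lipschitz_on {0..T} \<gamma>"
      using hor unfolding heis_horizontal_def by blast
    then have "\<exists>L. L-lipschitz_on {0..T} (\<lambda>t. \<Phi> (\<gamma> t))"
      by (rule lipschitz_on_interval_compose[OF D cont])
    moreover have "AE t in lebesgue. t \<in> {0..T} \<longrightarrow>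
        ((\<lambda>t. \<Phi> (\<gamma> t)) has_vector_derivative v1 t *\<^sub>R X1 (\<Phi> (\<gamma> t)) + v2 t *\<^sub>R X2 (\<Phi> (\<gamma> t)))
          (at t within {0..T})"
      using conjunct2[OF hor[unfolded heis_horizontal_def]]
    proof eventually_elim
      case (elim t)
      show ?case
      proof
        assume "t \<in> {0..T}"
        with elim have "((\<Phi> \<circ> \<gamma>) has_vector_derivative
            D (\<gamma> t) (u1 t *\<^sub>R X1 (\<gamma> t) + u2 t *\<^sub>R X2 (\<gamma> t))) (at t within {0..T})"
          by (intro vector_derivative_diff_chain_within has_derivative_at_withinI[OF D]) simp
        then show "((\<lambda>t. \<Phi> (\<gamma> t)) has_vector_derivative
            v1 t *\<^sub>R X1 (\<Phi> (\<gamma> t)) + v2 t *\<^sub>R X2 (\<Phi> (\<gamma> t))) (at t within {0..T})"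
          unfolding v comp_def .
      qed
    qed
    ultimately have "heis_horizontal T (\<lambda>t. \<Phi> (\<gamma> t)) v1 v2"
      unfolding heis_horizontal_def by blast
    then have "heis_dist (\<Phi> p) (\<Phi> q) \<le> control_length T v1 v2"
      unfolding heis_dist_def using T ends by (intro Inf_lower) blast
    also have "\<dots> \<le> control_length T u1 u2"
      unfolding control_length_def
      by (intro nn_integral_mono mult_right_mono ennreal_leI real_sqrt_le_mono le) auto
    finally show ?thesis .
  qed
  then show ?thesis
    unfolding heis_dist_def[of p q] by (intro Inf_greatest) blast
qed

section \<open>Left translations, automorphisms and an explicit arc\<close>

lemma left_translation_has_derivative:
  "((\<lambda>p. h \<otimes>\<^bsub>heis\<^esub> p) has_derivative
      (\<lambda>v. (fst v, fst (snd v), snd (snd v) + fst h * fst (snd v)))) (at p)"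
proof -
  have "(\<lambda>p. h \<otimes>\<^bsub>heis\<^esub> p) =
      (\<lambda>p. (fst h + fst p, fst (snd h) + fst (snd p), snd (snd h) + snd (snd p) + fst h * fst (snd p)))"
    by (cases h) (auto simp: heis_def)
  then show ?thesis
    by (auto intro!: derivative_eq_intros)
qed

lemma left_translation_invariant_fields:
  "(\<lambda>v. (fst v, fst (snd v), snd (snd v) + fst h * fst (snd v))) (u1 *\<^sub>R X1 p + u2 *\<^sub>R X2 p)
     = u1 *\<^sub>R X1 (h \<otimes>\<^bsub>heis\<^esub> p) + u2 *\<^sub>R X2 (h \<otimes>\<^bsub>heis\<^esub> p)"
  by (cases h; cases p) (simp add: heis_def X1_def X2_def algebra_simps)

lemma horizontal_contraction_left_translation:
  "horizontal_contraction (\<lambda>p. h \<otimes>\<^bsub>heis\<^esub> p)"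
  unfolding horizontal_contraction_def
proof (intro exI conjI allI)
  show "((\<lambda>p. h \<otimes>\<^bsub>heis\<^esub> p) has_derivative
      (\<lambda>v. (fst v, fst (snd v), snd (snd v) + fst h * fst (snd v)))) (at p)" for p
    by (rule left_translation_has_derivative)
qed (rule continuous_on_const left_translation_invariant_fields order_refl)+

text \<open>The linear map of the plane with matrix rows \<open>(\<alpha>, \<beta>)\<close> and \<open>(\<gamma>, \<delta>)\<close> multiplies areas by its
  determinant. Hence it lifts to the group endomorphism that multiplies \<open>z = c - a * b / 2\<close> by the
  determinant; below it is written in the coordinates \<open>(a, b, c)\<close>.\<close>

definition heis_linear :: "real \<Rightarrow> real \<Rightarrow> real \<Rightarrow> real \<Rightarrow> point \<Rightarrow> point" where
  "heis_linear \<alpha> \<beta> \<gamma> \<delta> = (\<lambda>(a, b, c). (\<alpha> * a + \<beta> * b, \<gamma> * a + \<delta> * b,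
     (\<alpha> * \<delta> - \<beta> * \<gamma>) * (c - a * b / 2) + (\<alpha> * a + \<beta> * b) * (\<gamma> * a + \<delta> * b) / 2))"

lemma horizontal_contraction_heis_linear:
  assumes contr: "\<And>x y. (\<alpha> * x + \<beta> * y)\<^sup>2 + (\<gamma> * x + \<delta> * y)\<^sup>2 \<le> x\<^sup>2 + y\<^sup>2"
  shows "horizontal_contraction (heis_linear \<alpha> \<beta> \<gamma> \<delta>)"
proof -
  define X Y :: "point \<Rightarrow> real" where "X = (\<lambda>p. \<alpha> * fst p + \<beta> * fst (snd p))"
    and "Y = (\<lambda>p. \<gamma> * fst p + \<delta> * fst (snd p))"
  define D :: "point \<Rightarrow> point \<Rightarrow> point" where
    "D = (\<lambda>p v. (X v, Y v,
       (\<alpha> * \<delta> - \<beta> * \<gamma>) * (snd (snd v) - (fst p * fst (snd v) + fst v * fst (snd p)) / 2)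
       + (X p * Y v + X v * Y p) / 2))"
  have heis_linear_eq: "heis_linear \<alpha> \<beta> \<gamma> \<delta> = (\<lambda>p. (X p, Y p,
      (\<alpha> * \<delta> - \<beta> * \<gamma>) * (snd (snd p) - fst p * fst (snd p) / 2) + X p * Y p / 2))"
    by (simp add: heis_linear_def case_prod_unfold X_def Y_def)
  have [derivative_intros]: "(X has_derivative X) (at p)" "(Y has_derivative Y) (at p)" for p
    unfolding X_def Y_def by (intro derivative_intros)+
  have "(heis_linear \<alpha> \<beta> \<gamma> \<delta> has_derivative D p) (at p)" for p
    unfolding heis_linear_eq D_def divide_inverse
    by (intro derivative_intros)
  moreover have "continuous_on UNIV (\<lambda>p. D p v)" for v
    unfolding D_def X_def Y_def by (intro continuous_intros) auto
  moreover have "D p (u1 *\<^sub>R X1 p + u2 *\<^sub>R X2 p) =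
      (\<alpha> * u1 + \<beta> * u2) *\<^sub>R X1 (heis_linear \<alpha> \<beta> \<gamma> \<delta> p) + (\<gamma> * u1 + \<delta> * u2) *\<^sub>R X2 (heis_linear \<alpha> \<beta> \<gamma> \<delta> p)"
    for p u1 u2
  proof -
    obtain a b c where p: "p = (a, b, c)" by (cases p)
    have "(\<alpha> * \<delta> - \<beta> * \<gamma>) * (u2 * a - (a * u2 + u1 * b) / 2)
        + ((\<alpha> * a + \<beta> * b) * (\<gamma> * u1 + \<delta> * u2) + (\<alpha> * u1 + \<beta> * u2) * (\<gamma> * a + \<delta> * b)) / 2
        = (\<gamma> * u1 + \<delta> * u2) * (\<alpha> * a + \<beta> * b)"
      by (simp add: field_simps)
    then show ?thesis
      by (simp add: p D_def heis_linear_eq X_def Y_def X1_def X2_def)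
  qed
  ultimately show ?thesis
    unfolding horizontal_contraction_def using contr by blast
qed

text \<open>The planar curve runs along the chord \<open>(- t / 2, t / 2)\<close> and bulges by the sine wave in the
  orthogonal direction \<open>(1, 1)\<close>; the third coordinate is \<open>\<integral> a db\<close>, as horizontality demands. The
  amplitude \<open>pi / 16\<close> is the one for which this integral vanishes at \<open>t = 1\<close>. Any other bulge with the
  same area would join the same points, but a sine keeps the speed bounded on the whole line,
  including the parts beyond the end points that a projected curve may visit.\<close>

definition sine_arc :: "real \<Rightarrow> point" where
  "sine_arc t = (- t / 2 + pi / 16 * sin (pi * t), t / 2 + pi / 16 * sin (pi * t),
     - t\<^sup>2 / 8 + (1 - cos (pi * t)) / 16 - pi / 32 * t * sin (pi * t) + pi\<^sup>2 / 512 * (sin (pi * t))\<^sup>2)"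

lemma sine_arc_0: "sine_arc 0 = (0, 0, 0)"
  by (simp add: sine_arc_def)

lemma sine_arc_1: "sine_arc 1 = (- 1/2, 1/2, 0)"
  by (simp add: sine_arc_def)

text \<open>With \<open>\<sigma> = - 1\<close> and \<open>\<sigma> = 1\<close> these are the derivatives of the first two coordinates of
  the arc.\<close>

definition sine_arc_control :: "real \<Rightarrow> real \<Rightarrow> real" where
  "sine_arc_control \<sigma> t = \<sigma> / 2 + pi\<^sup>2 / 16 * cos (pi * t)"

lemma sine_arc_has_vector_derivative:
  "(sine_arc has_vector_derivative
      sine_arc_control (- 1) t *\<^sub>R X1 (sine_arc t) + sine_arc_control 1 t *\<^sub>R X2 (sine_arc t)) (at t)"
proof -
  have "((\<lambda>t. - t / 2 + pi / 16 * sin (pi * t)) has_real_derivative sine_arc_control (- 1) t) (at t)"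
    unfolding sine_arc_control_def
    by (rule derivative_eq_intros refl | simp add: power2_eq_square)+
  moreover have "((\<lambda>t. t / 2 + pi / 16 * sin (pi * t)) has_real_derivative sine_arc_control 1 t) (at t)"
    unfolding sine_arc_control_def
    by (rule derivative_eq_intros refl | simp add: power2_eq_square)+
  moreover have "((\<lambda>t. - t\<^sup>2 / 8 + (1 - cos (pi * t)) / 16 - pi / 32 * t * sin (pi * t)
        + pi\<^sup>2 / 512 * (sin (pi * t))\<^sup>2) has_real_derivative
      (- t / 2 + pi / 16 * sin (pi * t)) * sine_arc_control 1 t) (at t)"
    unfolding sine_arc_control_def
    by (rule derivative_eq_intros refl | simp add: power2_eq_square algebra_simps)+
  ultimately show ?thesis
    unfolding sine_arc_def X1_def X2_def has_real_derivative_iff_has_vector_derivative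
    by (auto intro!: has_vector_derivative_Pair simp: mult.commute)
qed

text \<open>The two controls differ only in the sign of \<open>1/2\<close>, so the mixed terms of the squares cancel,
  and what is left is controlled by the crude bound \<open>pi < 4\<close>.\<close>

lemma sine_arc_speed:
  "(sine_arc_control (- 1) t)\<^sup>2 + (sine_arc_control 1 t)\<^sup>2 \<le> 5 / 2"
proof -
  have "pi ^ 4 * (cos (pi * t))\<^sup>2 \<le> 4 ^ 4 * 1"
    using pi_less_4 pi_gt_zero by (intro mult_mono power_mono) (auto simp: abs_square_le_1)
  moreover have "(sine_arc_control (- 1) t)\<^sup>2 + (sine_arc_control 1 t)\<^sup>2
      = 1 / 2 + pi ^ 4 * (cos (pi * t))\<^sup>2 / 128"
    by (simp add: sine_arc_control_def power2_eq_square power4_eq_xxxx field_simps)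
  ultimately show ?thesis by simp
qed

text \<open>Projecting to the direction \<open>(A, B)\<close> and rescaling so that \<open>(A, B)\<close> goes to \<open>1\<close> divides the speed
  of a curve by at least the length of \<open>(A, B)\<close>; this gain pays for the speed of the arc.\<close>

lemma horizontal_contraction_onto_sine_arc:
  fixes A B :: real
  assumes far: "5 / 2 \<le> A\<^sup>2 + B\<^sup>2"
  shows "horizontal_contraction (\<lambda>p. sine_arc ((A * fst p + B * fst (snd p)) / (A\<^sup>2 + B\<^sup>2)))"
proof -
  define f :: "point \<Rightarrow> real" where "f p = (A * fst p + B * fst (snd p)) / (A\<^sup>2 + B\<^sup>2)" for p
  define w where "w t = sine_arc_control (- 1) t *\<^sub>R X1 (sine_arc t) + sine_arc_control 1 t *\<^sub>R X2 (sine_arc t)" for t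
  have f: "(f has_derivative f) (at p)" for p
    unfolding f_def using far by (auto intro!: derivative_eq_intros)
  have "((\<lambda>p. sine_arc (f p)) has_derivative (\<lambda>v. f v *\<^sub>R w (f p))) (at p)" for p
    using has_derivative_compose[OF f sine_arc_has_vector_derivative[unfolded has_vector_derivative_def]]
    unfolding w_def .
  moreover have "continuous_on UNIV (\<lambda>p. f v *\<^sub>R w (f p))" for v
    using far unfolding w_def f_def sine_arc_def sine_arc_control_def X1_def X2_def case_prod_unfold
    by (auto intro!: continuous_intros)
  moreover have "\<exists>v1 v2. f (u1 *\<^sub>R X1 p + u2 *\<^sub>R X2 p) *\<^sub>R w (f p)
      = v1 *\<^sub>R X1 (sine_arc (f p)) + v2 *\<^sub>R X2 (sine_arc (f p)) \<and> v1\<^sup>2 + v2\<^sup>2 \<le> u1\<^sup>2 + u2\<^sup>2" for p u1 u2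
  proof -
    define \<mu> where "\<mu> = (A * u1 + B * u2) / (A\<^sup>2 + B\<^sup>2)"
    have \<mu>: "f (u1 *\<^sub>R X1 p + u2 *\<^sub>R X2 p) = \<mu>"
      by (cases p) (simp add: f_def \<mu>_def X1_def X2_def)
    \<comment> \<open>Lagrange's identity, for the Cauchy--Schwarz inequality.\<close>
    have "(A * u1 + B * u2)\<^sup>2 + (A * u2 - B * u1)\<^sup>2 = (A\<^sup>2 + B\<^sup>2) * (u1\<^sup>2 + u2\<^sup>2)"
      by algebra
    then have "(A * u1 + B * u2)\<^sup>2 \<le> (A\<^sup>2 + B\<^sup>2) * (u1\<^sup>2 + u2\<^sup>2)"
      using zero_le_power2[of "A * u2 - B * u1"] by linarith
    then have "\<mu>\<^sup>2 * (A\<^sup>2 + B\<^sup>2) \<le> u1\<^sup>2 + u2\<^sup>2"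
      using far by (simp add: \<mu>_def power_divide power2_eq_square[of "A\<^sup>2 + B\<^sup>2"] divide_le_eq mult.commute)
    moreover have "\<mu>\<^sup>2 * ((sine_arc_control (- 1) (f p))\<^sup>2 + (sine_arc_control 1 (f p))\<^sup>2) \<le> \<mu>\<^sup>2 * (A\<^sup>2 + B\<^sup>2)"
      using sine_arc_speed[of "f p"] far by (intro mult_left_mono) auto
    ultimately show ?thesis
      by (intro exI[of _ "\<mu> * sine_arc_control (- 1) (f p)"] exI[of _ "\<mu> * sine_arc_control 1 (f p)"])
         (auto simp: \<mu> w_def scaleR_add_right power_mult_distrib ring_distribs)
  qed
  ultimately show ?thesis
    unfolding horizontal_contraction_def f_def[symmetric]
    by (intro exI[of _ "\<lambda>p v. f v *\<^sub>R w (f p)"]) auto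
qed

section \<open>The points above the centre of the fundamental cube\<close>

text \<open>In the coset of the centre the planar coordinates are half-odd, so that either both have
  modulus \<open>1/2\<close> or their squares add up to at least \<open>1/4 + 9/4\<close>.\<close>

lemma heis_dist_le_of_centre_coset:
  assumes g: "g \<in> nil_proj (1/2, 1/2, 1/2)"
  shows "heis_dist (1, 0, 0) (1/2, 1/2, 1/2) \<le> heis_dist (0, 0, 0) g"
proof -
  have "heis_dist (1, 0, 0) (1/2, 1/2, 1/2) \<le> heis_dist (0, 0, 0) (- 1/2, 1/2, 0)"
    using heis_dist_horizontal_contraction[OF horizontal_contraction_left_translation,
        of "(1, 0, 0)" "(0, 0, 0)" "(- 1/2, 1/2, 0)"]
    by (simp add: heis_mult)
  also have "\<dots> \<le> heis_dist (0, 0, 0) g"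
  proof -
    obtain x y z where "(x, y, z) \<in> heis_int" and gx: "g = (x, y, z) \<otimes>\<^bsub>heis\<^esub> (1/2, 1/2, 1/2)"
      using g unfolding nil_proj_def r_coset_def by force
    then obtain k l m :: int where klm: "x = of_int k" "y = of_int l" "z = of_int m"
      unfolding heis_int_def by (auto elim!: Ints_cases)
    define A B :: real where "A = of_int k + 1/2" and "B = of_int l + 1/2"
    \<comment> \<open>The integer \<open>n\<close> is eight times the coordinate \<open>z\<close> of \<open>g\<close>.\<close>
    define n :: int where "n = 3 + 8 * m + 2 * k - 2 * l - 4 * k * l"
    have g_eq: "g = (A, B, of_int n / 8 + A * B / 2)"
      by (simp add: gx klm heis_mult A_def B_def n_def field_simps)
    show ?thesis
    proof (cases "k \<in> {- 1, 0} \<and> l \<in> {- 1, 0}")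
      case True
      then have AB: "A\<^sup>2 + B\<^sup>2 = 1/2"
        by (auto simp: A_def B_def power2_eq_square)
      have "odd n" by (simp add: n_def)
      then have "n \<noteq> 0" by auto
      then have "1 \<le> \<bar>n\<bar>" by linarith
      define s :: real where "s = 1 / of_int n"
      have s: "s * of_int n = 1" using \<open>n \<noteq> 0\<close> by (simp add: s_def)
      have "\<bar>s\<bar> \<le> 1" using \<open>1 \<le> \<bar>n\<bar>\<close> by (simp add: s_def abs_divide)
      then have s1: "s\<^sup>2 \<le> 1" by (simp add: abs_square_le_1)
      \<comment> \<open>The linear part sends \<open>(A, B)\<close> to \<open>(- 1/2, 1/2)\<close> and its rotation \<open>(- B, A)\<close> to \<open>s\<close>
        times the rotation \<open>(- 1/2, - 1/2)\<close> of \<open>(- 1/2, 1/2)\<close>; thus its determinant is \<open>s\<close>.\<close>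
      define \<Phi> where "\<Phi> = heis_linear (- A + s * B) (- B - s * A) (A + s * B) (B - s * A)"
      have "horizontal_contraction \<Phi>"
        unfolding \<Phi>_def
      proof (rule horizontal_contraction_heis_linear)
        fix x y :: real
        have "((- A + s * B) * x + (- B - s * A) * y)\<^sup>2 + ((A + s * B) * x + (B - s * A) * y)\<^sup>2
            = 2 * (A * x + B * y)\<^sup>2 + 2 * (s\<^sup>2 * (A * y - B * x)\<^sup>2)"
          by algebra
        also have "\<dots> \<le> 2 * (A * x + B * y)\<^sup>2 + 2 * (1 * (A * y - B * x)\<^sup>2)"
          using s1 by (intro add_left_mono mult_left_mono mult_right_mono) auto
        also have "\<dots> = 2 * (A\<^sup>2 + B\<^sup>2) * (x\<^sup>2 + y\<^sup>2)"
          by algebra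
        finally show "((- A + s * B) * x + (- B - s * A) * y)\<^sup>2 + ((A + s * B) * x + (B - s * A) * y)\<^sup>2
            \<le> x\<^sup>2 + y\<^sup>2"
          by (simp add: AB)
      qed
      then have "heis_dist (\<Phi> (0, 0, 0)) (\<Phi> g) \<le> heis_dist (0, 0, 0) g"
        by (rule heis_dist_horizontal_contraction)
      moreover have "\<Phi> (0, 0, 0) = (0, 0, 0)"
        by (simp add: \<Phi>_def heis_linear_def)
      moreover have "\<Phi> g = (- 1/2, 1/2, 0)"
      proof -
        have "(- A + s * B) * A + (- B - s * A) * B = - (A\<^sup>2 + B\<^sup>2)"
          and "(A + s * B) * A + (B - s * A) * B = A\<^sup>2 + B\<^sup>2"
          and "(- A + s * B) * (B - s * A) - (- B - s * A) * (A + s * B) = 2 * s * (A\<^sup>2 + B\<^sup>2)"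
          by algebra+
        then show ?thesis
          using s by (simp add: \<Phi>_def heis_linear_def g_eq AB)
      qed
      ultimately show ?thesis by simp
    next
      case False
      have half: "1/4 \<le> (of_int j + 1/2 :: real)\<^sup>2" for j :: int
      proof -
        have "0 \<le> j * (j + 1)" by (cases "0 \<le> j") (auto simp: mult_nonpos_nonpos)
        then have "0 \<le> (of_int (j * (j + 1)) :: real)" by linarith
        then show ?thesis by (simp add: power2_eq_square algebra_simps)
      qed
      have far: "9/4 \<le> (of_int j + 1/2 :: real)\<^sup>2" if "j \<notin> {- 1, 0}" for j :: int
      proof -
        have "0 \<le> (j - 1) * (j + 2)"
          using that by (cases "0 \<le> j") (auto simp: mult_nonpos_nonpos)
        then have "0 \<le> (of_int ((j - 1) * (j + 2)) :: real)" by linarith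
        then show ?thesis by (simp add: power2_eq_square algebra_simps)
      qed
      have R: "5/2 \<le> A\<^sup>2 + B\<^sup>2"
        using False half[of k] half[of l] far[of k] far[of l] unfolding A_def B_def by force
      then have pos: "A\<^sup>2 + B\<^sup>2 \<noteq> 0" by linarith
      have ratio: "(A * fst g + B * fst (snd g)) / (A\<^sup>2 + B\<^sup>2) = 1"
        unfolding g_eq fst_conv snd_conv power2_eq_square[symmetric] using pos by (rule divide_self)
      then show ?thesis
        using heis_dist_horizontal_contraction[OF horizontal_contraction_onto_sine_arc[OF R],
            of "(0, 0, 0)" g]
        unfolding ratio by (simp add: sine_arc_0 sine_arc_1)
    qed
  qed
  finally show ?thesis .
qed

section \<open>Lifting horizontal curves from the nilmanifold\<close>

lemma nil_proj_left_translate: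
  assumes "h \<in> heis_int"
  shows "nil_proj (h \<otimes>\<^bsub>heis\<^esub> g) = nil_proj g"
proof -
  interpret group heis by (rule group_heis)
  have carrier: "x \<in> carrier heis" for x by (simp add: heis_def)
  have "heis_int #>\<^bsub>heis\<^esub> (h \<otimes>\<^bsub>heis\<^esub> g) = heis_int #>\<^bsub>heis\<^esub> h #>\<^bsub>heis\<^esub> g"
    using carrier by (intro coset_mult_assoc[symmetric]) auto
  also have "heis_int #>\<^bsub>heis\<^esub> h = heis_int"
    using assms carrier by (intro coset_join2 subgroup_heis_int)
  finally show ?thesis unfolding nil_proj_def .
qed

lemma mem_nil_proj: "g \<in> nil_proj g"
  by (cases g) (force simp: nil_proj_def r_coset_def heis_int_def heis_def)

lemma nil_proj_eqE:
  assumes "nil_proj p = nil_proj q"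
  obtains h where "h \<in> heis_int" "p = h \<otimes>\<^bsub>heis\<^esub> q"
proof -
  have "p \<in> nil_proj q" using mem_nil_proj[of p] assms by simp
  then show ?thesis using that unfolding nil_proj_def r_coset_def by blast
qed

lemma nil_chart_nil_proj:
  assumes "chart_domain U" "p \<in> U"
  shows "nil_chart U (nil_proj p) = p"
  using assms unfolding chart_domain_def nil_chart_def by simp

text \<open>This is path lifting for a covering map, with the Lipschitz property carried along. Within a
  chart the chart itself gives a lift, which a left translation by a lattice element moves to the
  prescribed starting point; lifts on adjacent intervals are concatenated, and bisection of the
  interval reduces the claim to intervals that are short enough to stay in one chart.\<close>

lemma nil_lipschitz_lift:
  assumes T: "0 < T" and lip: "nil_lipschitz T \<gamma>" and g: "nil_proj g = \<gamma> 0"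
  obtains \<sigma> L where "L-lipschitz_on {0..T} \<sigma>" "\<sigma> 0 = g" "\<And>t. t \<in> {0..T} \<Longrightarrow> nil_proj (\<sigma> t) = \<gamma> t"
proof -
  \<comment> \<open>The starting point of the lift is arbitrary in the fibre, which is what makes
    concatenation possible.\<close>
  define P where "P a b \<longleftrightarrow> 0 \<le> a \<and> a \<le> b \<and> b \<le> T \<longrightarrow> (\<forall>g. nil_proj g = \<gamma> a \<longrightarrow>
      (\<exists>\<sigma> L. L-lipschitz_on {a..b} \<sigma> \<and> \<sigma> a = g \<and> (\<forall>t\<in>{a..b}. nil_proj (\<sigma> t) = \<gamma> t)))" for a b
  have "P 0 T"
  proof (rule Bolzano)
    show "0 \<le> T" using T by simp
  next
    fix a b c assume ab: "P a b" and bc: "P b c" and le: "a \<le> b" "b \<le> c"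
    show "P a c"
      unfolding P_def
    proof (intro impI allI)
      fix g assume ac: "0 \<le> a \<and> a \<le> c \<and> c \<le> T" and g: "nil_proj g = \<gamma> a"
      obtain \<sigma> L where \<sigma>: "L-lipschitz_on {a..b} \<sigma>" "\<sigma> a = g" "\<forall>t\<in>{a..b}. nil_proj (\<sigma> t) = \<gamma> t"
        using ab ac g le unfolding P_def by (meson order_trans)
      then have "nil_proj (\<sigma> b) = \<gamma> b" using le by simp
      then obtain \<rho> M where \<rho>: "M-lipschitz_on {b..c} \<rho>" "\<rho> b = \<sigma> b" "\<forall>t\<in>{b..c}. nil_proj (\<rho> t) = \<gamma> t"
        using bc ac le unfolding P_def by (meson order_trans)
      have "(max L M)-lipschitz_on {a..c} (\<lambda>t. if t \<le> b then \<sigma> t else \<rho> t)"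
        using \<sigma> \<rho> by (intro lipschitz_on_concat_max) auto
      then show "\<exists>\<sigma> L. L-lipschitz_on {a..c} \<sigma> \<and> \<sigma> a = g \<and> (\<forall>t\<in>{a..c}. nil_proj (\<sigma> t) = \<gamma> t)"
        using \<sigma> \<rho> le by (intro exI[of _ "\<lambda>t. if t \<le> b then \<sigma> t else \<rho> t"] exI[of _ "max L M"]) auto
    qed
  next
    fix s assume "0 \<le> s" "s \<le> T"
    then obtain U \<epsilon> L where U: "chart_domain U" and \<epsilon>: "0 < \<epsilon>"
      and im: "\<gamma> ` ({0..T} \<inter> ball s \<epsilon>) \<subseteq> nil_proj ` U"
      and L: "L-lipschitz_on ({0..T} \<inter> ball s \<epsilon>) (nil_chart U \<circ> \<gamma>)"
      using lip unfolding nil_lipschitz_def by (meson atLeastAtMost_iff)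
    have proj: "nil_proj (nil_chart U (\<gamma> t)) = \<gamma> t" if "t \<in> {0..T} \<inter> ball s \<epsilon>" for t
      using that im unfolding nil_chart_def by (intro f_inv_into_f) blast
    have "P a b" if ab: "a \<le> s \<and> s \<le> b \<and> b - a < \<epsilon>" for a b
      unfolding P_def
    proof (intro impI allI)
      fix g assume ab': "0 \<le> a \<and> a \<le> b \<and> b \<le> T" and g: "nil_proj g = \<gamma> a"
      have sub: "{a..b} \<subseteq> {0..T} \<inter> ball s \<epsilon>"
        using ab ab' by (auto simp: dist_real_def)
      then have "nil_proj g = nil_proj (nil_chart U (\<gamma> a))"
        using g ab' proj[of a] by auto
      then obtain h where h: "h \<in> heis_int" "g = h \<otimes>\<^bsub>heis\<^esub> nil_chart U (\<gamma> a)"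
        by (rule nil_proj_eqE)
      obtain M where "M-lipschitz_on {a..b} (\<lambda>t. h \<otimes>\<^bsub>heis\<^esub> (nil_chart U \<circ> \<gamma>) t)"
        using lipschitz_on_interval_compose[OF left_translation_has_derivative _ lipschitz_on_subset[OF L sub]]
        by fastforce
      then show "\<exists>\<sigma> L. L-lipschitz_on {a..b} \<sigma> \<and> \<sigma> a = g \<and> (\<forall>t\<in>{a..b}. nil_proj (\<sigma> t) = \<gamma> t)"
        using h sub proj
        by (intro exI[of _ "\<lambda>t. h \<otimes>\<^bsub>heis\<^esub> (nil_chart U \<circ> \<gamma>) t"] exI[of _ M])
           (auto simp: nil_proj_left_translate)
    qed
    then show "\<exists>d>0. \<forall>a b. a \<le> s \<and> s \<le> b \<and> b - a < d \<longrightarrow> P a b"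
      using \<epsilon> by blast
  qed
  then show ?thesis
    using that g T unfolding P_def by (metis less_imp_le order_refl)
qed

text \<open>Near \<open>t\<close> a continuous lift and the curve in the chart differ by one fixed lattice element,
  because the chart is injective on an open set that contains the translated lift. Left
  translations preserve \<open>X1\<close> and \<open>X2\<close>, so both have the same controls.\<close>

lemma lift_has_vector_derivative:
  fixes \<sigma> :: "real \<Rightarrow> point"
  assumes cont: "continuous_on S \<sigma>" and t: "t \<in> S"
    and proj: "\<And>s. s \<in> S \<Longrightarrow> nil_proj (\<sigma> s) = \<gamma> s"
    and U: "chart_domain U" "\<gamma> t \<in> nil_proj ` U"
    and deriv: "((nil_chart U \<circ> \<gamma>) has_vector_derivative
          v1 *\<^sub>R X1 (nil_chart U (\<gamma> t)) + v2 *\<^sub>R X2 (nil_chart U (\<gamma> t))) (at t within S)"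
  shows "(\<sigma> has_vector_derivative v1 *\<^sub>R X1 (\<sigma> t) + v2 *\<^sub>R X2 (\<sigma> t)) (at t within S)"
proof -
  interpret group heis by (rule group_heis)
  have carrier: "x \<in> carrier heis" for x by (simp add: heis_def)
  define p where "p = nil_chart U (\<gamma> t)"
  have p: "p \<in> U" "nil_proj p = \<gamma> t"
    unfolding p_def nil_chart_def
    by (rule inv_into_into[OF U(2)], rule f_inv_into_f[OF U(2)])
  then have "nil_proj (\<sigma> t) = nil_proj p" using proj t by simp
  then obtain h where h: "h \<in> heis_int" "\<sigma> t = h \<otimes>\<^bsub>heis\<^esub> p"
    by (rule nil_proj_eqE)
  define k where "k = inv\<^bsub>heis\<^esub> h"
  have k: "k \<in> heis_int"
    unfolding k_def using h subgroup_heis_int by (simp add: subgroup.m_inv_closed)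
  have hk: "h \<otimes>\<^bsub>heis\<^esub> (k \<otimes>\<^bsub>heis\<^esub> x) = x" and kh: "k \<otimes>\<^bsub>heis\<^esub> (h \<otimes>\<^bsub>heis\<^esub> x) = x" for x
    unfolding k_def m_assoc[OF carrier carrier carrier, symmetric] using carrier by simp_all
  have "continuous_on UNIV (\<lambda>p. k \<otimes>\<^bsub>heis\<^esub> p)"
    by (rule has_derivative_continuous_on[OF has_derivative_at_withinI[OF left_translation_has_derivative]])
  then have "continuous_on S (\<lambda>s. k \<otimes>\<^bsub>heis\<^esub> \<sigma> s)"
    by (rule continuous_on_compose2[OF _ cont]) simp
  moreover have in_U: "k \<otimes>\<^bsub>heis\<^esub> \<sigma> t \<in> U" unfolding h(2) kh by (rule p(1))
  moreover have "open U" using U by (simp add: chart_domain_def)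
  ultimately have "\<forall>\<^sub>F s in at t within S. k \<otimes>\<^bsub>heis\<^esub> \<sigma> s \<in> U"
    using t in_U unfolding continuous_on_def by (intro topological_tendstoD) auto
  then obtain d where d: "0 < d"
    and near: "\<And>s. s \<in> S \<Longrightarrow> s \<noteq> t \<Longrightarrow> dist s t < d \<Longrightarrow> k \<otimes>\<^bsub>heis\<^esub> \<sigma> s \<in> U"
    unfolding eventually_at by blast
  have eq: "h \<otimes>\<^bsub>heis\<^esub> (nil_chart U \<circ> \<gamma>) s = \<sigma> s" if "s \<in> S" "dist s t < d" for s
  proof -
    have "nil_proj (k \<otimes>\<^bsub>heis\<^esub> \<sigma> s) = \<gamma> s"
      using that proj k by (simp add: nil_proj_left_translate)
    moreover have "k \<otimes>\<^bsub>heis\<^esub> \<sigma> s \<in> U"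
      using near in_U that by (cases "s = t") auto
    ultimately have "(nil_chart U \<circ> \<gamma>) s = k \<otimes>\<^bsub>heis\<^esub> \<sigma> s"
      using nil_chart_nil_proj[OF U(1)] by (metis comp_apply)
    then show ?thesis by (simp only: hk)
  qed
  have "((\<lambda>s. h \<otimes>\<^bsub>heis\<^esub> (nil_chart U \<circ> \<gamma>) s) has_vector_derivative
      v1 *\<^sub>R X1 (h \<otimes>\<^bsub>heis\<^esub> p) + v2 *\<^sub>R X2 (h \<otimes>\<^bsub>heis\<^esub> p)) (at t within S)"
    using vector_derivative_diff_chain_within[OF deriv
        has_derivative_at_withinI[OF left_translation_has_derivative[of h]]]
    unfolding p_def[symmetric] left_translation_invariant_fields comp_def .
  then have "(\<sigma> has_vector_derivative
      v1 *\<^sub>R X1 (h \<otimes>\<^bsub>heis\<^esub> p) + v2 *\<^sub>R X2 (h \<otimes>\<^bsub>heis\<^esub> p)) (at t within S)"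
    by (rule has_vector_derivative_transform_within[OF _ d t eq])
  then show ?thesis by (simp add: h(2))
qed

proposition nil_horizontal_lift:
  assumes T: "0 < T" and hor: "nil_horizontal T \<gamma> u1 u2" and g: "nil_proj g = \<gamma> 0"
  obtains \<sigma> where "heis_horizontal T \<sigma> u1 u2" "\<sigma> 0 = g" "nil_proj (\<sigma> T) = \<gamma> T"
proof -
  have lip: "nil_lipschitz T \<gamma>"
    using hor unfolding nil_horizontal_def by (rule conjunct1)
  obtain \<sigma> L where \<sigma>: "L-lipschitz_on {0..T} \<sigma>" "\<sigma> 0 = g" "\<And>t. t \<in> {0..T} \<Longrightarrow> nil_proj (\<sigma> t) = \<gamma> t"
    using nil_lipschitz_lift[OF T lip g] by blast
  have "AE t in lebesgue. t \<in> {0..T} \<longrightarrow>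
      (\<sigma> has_vector_derivative u1 t *\<^sub>R X1 (\<sigma> t) + u2 t *\<^sub>R X2 (\<sigma> t)) (at t within {0..T})"
    using conjunct2[OF hor[unfolded nil_horizontal_def]]
  proof eventually_elim
    case (elim t)
    then show ?case
      using lift_has_vector_derivative[OF lipschitz_on_continuous_on[OF \<sigma>(1)] _ \<sigma>(3)] by blast
  qed
  then have "heis_horizontal T \<sigma> u1 u2"
    unfolding heis_horizontal_def using \<sigma>(1) by blast
  then show ?thesis using that \<sigma> T by simp
qed

corollary nil_dist_ge:
  assumes "\<And>g. g \<in> nil_proj q \<Longrightarrow> d \<le> heis_dist p g"
  shows "d \<le> nil_dist (nil_proj p) (nil_proj q)"
  unfolding nil_dist_def
proof (intro Inf_greatest, clarify)
  fix T u1 u2 \<gamma>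
  assume T: "0 < T" and hor: "nil_horizontal T \<gamma> u1 u2" and ends: "\<gamma> 0 = nil_proj p" "\<gamma> T = nil_proj q"
  obtain \<sigma> where \<sigma>: "heis_horizontal T \<sigma> u1 u2" "\<sigma> 0 = p" "nil_proj (\<sigma> T) = \<gamma> T"
    using nil_horizontal_lift[OF T hor ends(1)[symmetric]] .
  have "\<sigma> T \<in> nil_proj q"
    using mem_nil_proj[of "\<sigma> T"] \<sigma>(3) ends(2) by simp
  then have "d \<le> heis_dist p (\<sigma> T)"
    by (rule assms)
  also have "\<dots> \<le> control_length T u1 u2"
    unfolding heis_dist_def using T \<sigma> by (intro Inf_lower) blast
  finally show "d \<le> control_length T u1 u2" .
qed

section \<open>The covering time\<close>

theorem theorem9p4:
  "t_bar \<ge> heis_dist (1, 0, 0) (1/2, 1/2, 1/2)"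
  unfolding t_bar_def
proof (intro Inf_greatest, clarify)
  fix t :: real assume "nil_ball t = nil_manifold"
  then have "nil_proj (1/2, 1/2, 1/2) \<in> nil_ball t"
    by (simp add: nil_manifold_eq)
  then have "nil_dist (nil_proj (0, 0, 0)) (nil_proj (1/2, 1/2, 1/2)) \<le> ennreal t"
    by (simp add: nil_ball_def heis_def)
  moreover have "heis_dist (1, 0, 0) (1/2, 1/2, 1/2) \<le> nil_dist (nil_proj (0, 0, 0)) (nil_proj (1/2, 1/2, 1/2))"
    by (intro nil_dist_ge heis_dist_le_of_centre_coset)
  ultimately show "heis_dist (1, 0, 0) (1/2, 1/2, 1/2) \<le> ennreal t"
    by (rule order_trans[rotated])
qed

end
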